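(* Let $T\in\mathbb N$, $s^0\in\mathbb N$, $\delta^\star\ge0$ and $\delta^0\ge0$. Assume that we observe the random element $y=\beta^\star\Phi_T(\vartheta^\star)+w_T$ of $L^2(\lambda_T)$ with unknown parameters $s\in\mathbb N$, $\beta^\star\in(\mathbb R^* )^s$ and $\vartheta^\star\in\Theta_T^s(\delta^\star)$. Let $\beta^0\in(\mathbb R^* )^{s^0}$ and $\vartheta^0\in\Theta_T^{s^0}(\delta^0)$. Suppose that the smoothness assumption on the features holds, and that the Noise Assumption holds for a noise level $\overline\sigma>0$ and a decay rate $\Delta_T>0$ (see context for both). Let $$\mathrm{Test}_1=\|y-\beta^0\Phi_T(\vartheta^0)\|^2_{L^2(\lambda_T)}-\mathbb E\left[\|w_T\|^2_{L^2(\lambda_T)}\right],\qquad \Psi_{\mathrm{Test}_1}(t)=\mathbf 1_{\{|\mathrm{Test}_1|>t\}},\qquad \Xi_T=\mathrm{Var}\left(\|w_T\|^2_{L^2(\lambda_T)}\right).$$ Then the maximal testing risk for the test problem $H_0$ against $H_1(\rho)$ defined in the context satisfies $$R_\rho\left(\Psi_{\mathrm{Test}_1}(t)\right)\le\frac{\Xi_T}{t^2}+\frac{4\,\Xi_T}{(\rho^2-t)^2}+\mathrm e^{-(\rho^2-t)^2/(32\,\overline\sigma^2\Delta_T\rho^2)}$$ for any threshold $t$ and any separation $\rho$ such that $\rho^2>t>0$.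
   Context: **Model.** $\mathbb N=\{0,1,\dots\}$, $\mathbb R^*=\mathbb R\setminus\{0\}$. $\Theta$ is either $\mathbb R$ or the torus $\mathbb R/\mathbb Z$, with Lebesgue measure $\mathrm{Leb}$; $|x-y|$ is the Euclidean distance on $\Theta$. $T\in\mathbb N$ is an index, $\lambda_T$ is a measure on the Borel $\sigma$-field of $\Theta$, $\mathfrak S\subset(0,\infty)$ is a set of scale parameters, $\sigma_T\in\mathfrak S$, and $h:\Theta\times\mathfrak S\to\mathbb R$. The features are $\varphi_T(\theta)=h(\theta-\cdot,\sigma_T)\in L^2(\lambda_T)$, normalized as $\phi_T(\theta)=\varphi_T(\theta)/\|\varphi_T(\theta)\|_{L^2(\lambda_T)}$. $\Theta_T$ is a compact interval of $\Theta$ ($\Theta_T=\Theta$ is allowed on the torus). For $\vartheta=(\theta_1,\dots,\theta_s)\in\Theta^s$ and $\beta\in\mathbb R^s$ write $\beta\Phi_T(\vartheta)=\sum_{k=1}^s\beta_k\phi_T(\theta_k)$; for $s=0$, $A^0=\{0\}$ for any set $A$ and $\beta\Phi_T(\vartheta)=0$. For $\delta\ge0$, $A^s(\delta)=\{(\theta_1,\dots,\theta_s)\in A^s:|\theta_\ell-\theta_k|>\delta\text{ for all distinct }k,\ell\}$, $A^0(\delta)=\{0\}$, $A^1(\delta)=A$. The noise $w_T$ is a random element of $L^2(\lambda_T)$. **Noise Assumption** (noise level $\overline\sigma>0$, decay rate $\Delta_T>0$). $w_T$ is a Gaussian process with $\mathbb E[\|w_T\|_{L^2(\lambda_T)}^4]<\infty$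 and, for all $f\in L^2(\lambda_T)$, $\langle f,w_T\rangle_{L^2(\lambda_T)}$ is a centered Gaussian variable with variance at most $\overline\sigma^2\Delta_T\|f\|^2_{L^2(\lambda_T)}$. **Smoothness of the features.** $\theta\mapsto h(\theta,\sigma_T)$ is of class $\mathcal C^3$ on $\Theta$, $\|h(\cdot,\sigma_T)\|_{L^2(\mathrm{Leb})}=1$, and for all $\theta\in\Theta$ and $i\in\{0,\dots,3\}$: $\|h(\theta-\cdot,\sigma_T)\|_{L^2(\lambda_T)}>0$, $\|\partial_\theta^ih(\cdot,\sigma_T)\|_{L^2(\mathrm{Leb})}<\infty$, $\|\partial_\theta^ih(\theta-\cdot,\sigma_T)\|_{L^2(\lambda_T)}<\infty$. **Test problem.** For given $\beta^0,\vartheta^0$ and $\rho\ge0$ (and given $s$, $\delta^\star$): $H_0$: $(\beta^\star,\vartheta^\star)\in(\mathbb R^* )^s\times\Theta_T^s(\delta^\star)$ with $\beta^\star\Phi_T(\vartheta^\star)=\beta^0\Phi_T(\vartheta^0)$; $H_1(\rho)$: $(\beta^\star,\vartheta^\star)\in(\mathbb R^* )^s\times\Theta_T^s(\delta^\star)$ with $\|\beta^\star\Phi_T(\vartheta^\star)-\beta^0\Phi_T(\vartheta^0)\|_{L^2(\lambda_T)}\ge\rho$. A test $\Psi$ is a measurable function of $y$ with values in $\{0,1\}$. Its maximal testing risk is $$R_\rho(\Psi)=\sup_{(\beta^\star,\vartheta^\star)\in H_0}\mathbb E_{(\beta^\star,\vartheta^\star)}[\Psi]+\sup_{(\beta^\star,\vartheta^\star)\in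 H_1(\rho)}\mathbb E_{(\beta^\star,\vartheta^\star)}[1-\Psi],$$ where under $\mathbb E_{(\beta^\star,\vartheta^\star)}$ one has $y=\beta^\star\Phi_T(\vartheta^\star)+w_T$. Under $H_0$ one has $y=\beta^0\Phi_T(\vartheta^0)+w_T$, and the first term (maximal type I error) is written $\mathbb E_{(\beta^0,\vartheta^0)}[\Psi]$. *)

theory Defs
  imports "HOL-Probability.Probability"
begin

section \<open>The parameter space: the real line or the torus\<close>

text \<open>
  A type of class \<open>line_or_torus\<close> is presented by an additive surjection \<open>wrap\<close> from the reals with
  kernel \<open>{0}\<close> (the line) or \<open>\<int>\<close> (the torus), with the quotient distance.  The axioms determine
  the type up to isometric isomorphism in each of the two cases; both instances are given below.
\<close>

class line_or_torus = ab_group_add + metric_space +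
  fixes wrap :: "real \<Rightarrow> 'a"
  assumes wrap_add: "wrap (x + y) = wrap x + wrap y"
    and surj_wrap: "surj wrap"
    and wrap_kernel: "{x. wrap x = 0} = {0} \<or> {x. wrap x = 0} = \<int>"
    and dist_wrap: "dist (wrap x) (wrap y) = Inf {\<bar>x - y + k\<bar> | k. wrap k = 0}"

instantiation real :: line_or_torus
begin

definition wrap_real :: "real \<Rightarrow> real" where
  "wrap_real x = x"

instance
  by standard (auto simp: wrap_real_def dist_real_def surj_def)

end

quotient_type torus = real / "\<lambda>x y. x - y \<in> \<int>"
proof (rule equivpI)
  show "reflp (\<lambda>x y::real. x - y \<in> \<int>)" by (simp add: reflp_def)
  show "symp (\<lambda>x y::real. x - y \<in> \<int>)"
    by (rule sympI, drule Ints_minus) simp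
  show "transp (\<lambda>x y::real. x - y \<in> \<int>)"
    by (rule transpI, drule (1) Ints_add) simp
qed

lemma Inf_abs_add_Ints: "Inf {\<bar>d + k\<bar> | k. k \<in> \<int>} = \<bar>d - of_int (round d)\<bar>" for d :: real
proof (rule cInf_eq_minimum)
  show "\<bar>d - of_int (round d)\<bar> \<in> {\<bar>d + k\<bar> | k. k \<in> \<int>}"
    by (auto intro!: exI[of _ "- of_int (round d)"])
  fix x assume "x \<in> {\<bar>d + k\<bar> | k. k \<in> \<int>}"
  then obtain m :: int where "x = \<bar>d + of_int m\<bar>"
    by (auto elim!: Ints_cases)
  with round_diff_minimal[of d "- m"] show "\<bar>d - of_int (round d)\<bar> \<le> x"
    by simp
qed

lemma Inf_abs_add_Ints_le: "k \<in> \<int> \<Longrightarrow> Inf {\<bar>d + k\<bar> | k. k \<in> \<int>} \<le> \<bar>d + k\<bar>" for d :: real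
  by (rule cInf_lower) (auto intro!: bdd_belowI[of _ 0])

lemma Inf_abs_add_Ints_attained:
  obtains k :: real where "k \<in> \<int>" "Inf {\<bar>d + k\<bar> | k. k \<in> \<int>} = \<bar>d + k\<bar>"
proof
  show "- of_int (round d) \<in> (\<int> :: real set)" by simp
  show "Inf {\<bar>d + k\<bar> | k. k \<in> \<int>} = \<bar>d + - of_int (round d)\<bar>"
    by (simp add: Inf_abs_add_Ints)
qed

instantiation torus :: ab_group_add
begin

lift_definition zero_torus :: torus is 0 .
lift_definition plus_torus :: "torus \<Rightarrow> torus \<Rightarrow> torus" is "(+)"
  by (drule (1) Ints_add) (simp add: algebra_simps)
lift_definition minus_torus :: "torus \<Rightarrow> torus \<Rightarrow> torus" is "(-)"
proof -
  fix x x' y y' :: real assume "x - x' \<in> \<int>" "y - y' \<in> \<int>"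
  hence "(x - x') - (y - y') \<in> \<int>" by (rule Ints_diff)
  thus "x - y - (x' - y') \<in> \<int>" by (simp add: algebra_simps)
qed
lift_definition uminus_torus :: "torus \<Rightarrow> torus" is uminus
  by (drule Ints_minus) simp

instance
  by standard (transfer, simp add: algebra_simps)+

end

instantiation torus :: metric_space
begin

lift_definition dist_torus :: "torus \<Rightarrow> torus \<Rightarrow> real" is
  "\<lambda>x y. Inf {\<bar>x - y + k\<bar> | k. k \<in> \<int>}"
proof -
  have *: "Inf {\<bar>x - y + k\<bar> | k. k \<in> \<int>} \<le> Inf {\<bar>x' - y' + k\<bar> | k. k \<in> \<int>}"
    if "x - x' \<in> \<int>" "y - y' \<in> \<int>" for x x' y y' :: real
  proof -
    obtain k where k: "k \<in> \<int>" "Inf {\<bar>x' - y' + k\<bar> | k. k \<in> \<int>} = \<bar>x' - y' + k\<bar>"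
      by (rule Inf_abs_add_Ints_attained)
    have "k - (x - x') + (y - y') \<in> \<int>"
      using that k by (intro Ints_add[OF Ints_diff])
    from Inf_abs_add_Ints_le[OF this, of "x - y"] show ?thesis
      using k by (simp add: algebra_simps)
  qed
  fix x x' y y' :: real assume xy: "x - x' \<in> \<int>" "y - y' \<in> \<int>"
  hence yx: "x' - x \<in> \<int>" "y' - y \<in> \<int>"
    using Ints_minus[of "x - x'"] Ints_minus[of "y - y'"] by simp_all
  show "Inf {\<bar>x - y + k\<bar> | k. k \<in> \<int>} = Inf {\<bar>x' - y' + k\<bar> | k. k \<in> \<int>}"
    by (rule antisym[OF *[OF xy] *[OF yx]])
qed

definition uniformity_torus :: "(torus \<times> torus) filter" where
  "uniformity_torus = (INF e\<in>{0 <..}. principal {(x, y). dist x y < e})"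

definition open_torus :: "torus set \<Rightarrow> bool" where
  "open_torus U \<longleftrightarrow> (\<forall>x\<in>U. eventually (\<lambda>(x', y). x' = x \<longrightarrow> y \<in> U) uniformity)"

instance
proof
  show "uniformity = (INF e\<in>{0 <..}. principal {(x :: torus, y). dist x y < e})"
    by (rule uniformity_torus_def)
  show "open U = (\<forall>x\<in>U. eventually (\<lambda>(x', y). x' = x \<longrightarrow> y \<in> U) uniformity)" for U :: "torus set"
    by (rule open_torus_def)
  have "(\<bar>d - of_int (round d)\<bar> = 0) = (d \<in> \<int>)" for d :: real
  proof
    assume "\<bar>d - of_int (round d)\<bar> = 0"
    hence "d = of_int (round d)" by simp
    thus "d \<in> \<int>" by (rule ssubst) (rule Ints_of_int)
  qed (elim Ints_cases, simp)
  thus "(dist x y = 0) = (x = y)" for x y :: torus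
    by (transfer, unfold Inf_abs_add_Ints)
  show "dist x y \<le> dist x z + dist y z" for x y z :: torus
  proof transfer
    fix x y z :: real
    obtain k where k: "k \<in> \<int>" "Inf {\<bar>x - z + k\<bar> | k. k \<in> \<int>} = \<bar>x - z + k\<bar>"
      by (rule Inf_abs_add_Ints_attained)
    obtain l where l: "l \<in> \<int>" "Inf {\<bar>y - z + l\<bar> | l. l \<in> \<int>} = \<bar>y - z + l\<bar>"
      by (rule Inf_abs_add_Ints_attained)
    have "k - l \<in> \<int>" using k l by simp
    from Inf_abs_add_Ints_le[OF this, of "x - y"]
    show "Inf {\<bar>x - y + k\<bar> | k. k \<in> \<int>} \<le>
        Inf {\<bar>x - z + k\<bar> | k. k \<in> \<int>} + Inf {\<bar>y - z + k\<bar> | k. k \<in> \<int>}"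
      unfolding k(2) l(2) by linarith
  qed
qed

end

instantiation torus :: line_or_torus
begin

lift_definition wrap_torus :: "real \<Rightarrow> torus" is "\<lambda>x. x" .

instance
proof
  show "wrap (x + y) = (wrap x + wrap y :: torus)" for x y
    by transfer simp
  show "surj (wrap :: real \<Rightarrow> torus)"
    unfolding surj_def by transfer (metis Ints_0 diff_self)
  have *: "wrap x = (0 :: torus) \<longleftrightarrow> x \<in> \<int>" for x
    by transfer simp
  show "{x. wrap x = (0 :: torus)} = {0} \<or> {x. wrap x = (0 :: torus)} = \<int>"
    by (simp add: *)
  show "dist (wrap x) (wrap y :: torus) = Inf {\<bar>x - y + k\<bar> | k. wrap k = (0 :: torus)}" for x y
    unfolding * by transfer simp
qed

end

definition compact_interval :: "'a::line_or_torus set \<Rightarrow> bool" where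
  "compact_interval I \<longleftrightarrow> (\<exists>a b. a \<le> b \<and> I = wrap ` {a..b})"

text \<open>Lebesgue measure, transported from a fundamental domain of \<open>wrap\<close>.\<close>

definition Leb :: "'a::line_or_torus measure" where
  "Leb = distr (restrict_space lborel (if inj (wrap :: real \<Rightarrow> 'a) then UNIV else {0..<1})) borel wrap"

lemma dist_wrap_le: "dist (wrap x) (wrap y :: 'a::line_or_torus) \<le> \<bar>x - y\<bar>"
proof -
  have "wrap 0 + wrap 0 = (wrap 0 :: 'a)"
    by (simp add: wrap_add[symmetric])
  hence "wrap 0 = (0 :: 'a)" by simp
  thus ?thesis
    unfolding dist_wrap by (intro cInf_lower bdd_belowI[of _ 0]) (auto intro!: exI[of _ 0])
qed

lemma wrap_measurable [measurable]: "(wrap :: real \<Rightarrow> 'a::line_or_torus) \<in> borel_measurable borel"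
proof (rule borel_measurable_continuous_onI)
  show "continuous_on UNIV (wrap :: real \<Rightarrow> 'a)"
    unfolding continuous_on_iff
  proof (intro ballI allI impI)
    fix x e :: real assume "e > 0"
    show "\<exists>d>0. \<forall>x'\<in>UNIV. dist x' x < d \<longrightarrow> dist (wrap x' :: 'a) (wrap x) < e"
      using \<open>e > 0\<close> by (intro exI[of _ e])
        (auto simp: dist_real_def intro: le_less_trans[OF dist_wrap_le])
  qed
qed

lemma Leb_real: "(Leb :: real measure) = lborel"
proof -
  have wrap: "wrap = (\<lambda>x::real. x)"
    by (rule ext) (rule wrap_real_def)
  have inj: "inj (\<lambda>x::real. x)" by (rule injI)
  show ?thesis
  proof (rule measure_eqI)
    show "emeasure (Leb :: real measure) A = emeasure lborel A" if "A \<in> sets Leb" for A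
      using that inj unfolding Leb_def wrap
      by (simp add: emeasure_distr emeasure_restrict_space measurable_restrict_space1
          space_restrict_space)
  qed (simp add: Leb_def)
qed

lemma emeasure_Leb_torus:
  assumes "A \<in> sets borel"
  shows "emeasure (Leb :: torus measure) A = emeasure lborel {x \<in> {0..<1}. wrap x \<in> A}"
proof -
  have "wrap 0 = (wrap 1 :: torus)" by transfer simp
  hence ninj: "\<not> inj (wrap :: real \<Rightarrow> torus)"
    by (metis injD zero_neq_one)
  have meas: "wrap \<in> measurable (restrict_space lborel {0..<1}) (borel :: torus measure)"
    by (rule measurable_restrict_space1) simp
  have "emeasure (Leb :: torus measure) A =
      emeasure (restrict_space lborel {0..<1}) {x \<in> {0..<1}. wrap x \<in> A}"
    using assms meas unfolding Leb_def
    by (simp add: ninj emeasure_distr space_restrict_space vimage_def Int_def conj_commute)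
  also have "\<dots> = emeasure lborel {x \<in> {0..<1}. wrap x \<in> A}"
    by (rule emeasure_restrict_space) auto
  finally show ?thesis .
qed

text \<open>On the torus, \<open>u \<mapsto> f (\<theta> + wrap u)\<close> is the \<open>1\<close>-periodic lift of \<open>f\<close> recentred at \<open>\<theta>\<close>.\<close>

definition Deriv :: "('a::line_or_torus \<Rightarrow> real) \<Rightarrow> 'a \<Rightarrow> real" where
  "Deriv f \<theta> = deriv (\<lambda>u. f (\<theta> + wrap u)) 0"

definition class_C :: "nat \<Rightarrow> ('a::line_or_torus \<Rightarrow> real) \<Rightarrow> bool" where
  "class_C n f \<longleftrightarrow>
     (\<forall>i<n. \<forall>\<theta>. (\<lambda>u. (Deriv ^^ i) f (\<theta> + wrap u)) differentiable (at 0)) \<and>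
     (\<forall>i\<le>n. continuous_on UNIV ((Deriv ^^ i) f))"


section \<open>Square-integrable functions and random elements\<close>

text \<open>
  Elements of the Hilbert space \<open>L\<^sup>2(\<mu>)\<close> are represented by functions, and equality in it is equality
  almost everywhere.
\<close>

definition L2 :: "'a measure \<Rightarrow> ('a \<Rightarrow> real) set" where
  "L2 \<mu> = {f \<in> borel_measurable \<mu>. integrable \<mu> (\<lambda>x. (f x)\<^sup>2)}"

definition L2_inner :: "'a measure \<Rightarrow> ('a \<Rightarrow> real) \<Rightarrow> ('a \<Rightarrow> real) \<Rightarrow> real" where
  "L2_inner \<mu> f g = (\<integral>x. f x * g x \<partial>\<mu>)"

definition L2_norm :: "'a measure \<Rightarrow> ('a \<Rightarrow> real) \<Rightarrow> real" where
  "L2_norm \<mu> f = sqrt (\<integral>x. (f x)\<^sup>2 \<partial>\<mu>)"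

definition L2_open :: "'a measure \<Rightarrow> ('a \<Rightarrow> real) set \<Rightarrow> bool" where
  "L2_open \<mu> U \<longleftrightarrow> U \<subseteq> L2 \<mu> \<and>
     (\<forall>f\<in>U. \<exists>e>0. \<forall>g\<in>L2 \<mu>. L2_norm \<mu> (\<lambda>x. g x - f x) < e \<longrightarrow> g \<in> U)"

definition L2_borel :: "'a measure \<Rightarrow> ('a \<Rightarrow> real) measure" where
  "L2_borel \<mu> = sigma (L2 \<mu>) {U. L2_open \<mu> U}"

lemma L2_add:
  assumes "f \<in> L2 \<mu>" "g \<in> L2 \<mu>"
  shows "(\<lambda>x. f x + g x) \<in> L2 \<mu>"
proof -
  have [measurable]: "f \<in> borel_measurable \<mu>" "g \<in> borel_measurable \<mu>"
    using assms by (auto simp: L2_def)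
  have "integrable \<mu> (\<lambda>x. 2 * (f x)\<^sup>2 + 2 * (g x)\<^sup>2)"
    using assms by (auto simp: L2_def)
  hence "integrable \<mu> (\<lambda>x. (f x + g x)\<^sup>2)"
  proof (rule Bochner_Integration.integrable_bound)
    show "AE x in \<mu>. norm ((f x + g x)\<^sup>2) \<le> norm (2 * (f x)\<^sup>2 + 2 * (g x)\<^sup>2)"
    proof (rule AE_I2)
      fix x
      have "0 \<le> (f x - g x)\<^sup>2" by simp
      hence "(f x + g x)\<^sup>2 \<le> 2 * (f x)\<^sup>2 + 2 * (g x)\<^sup>2"
        by (simp add: power2_sum power2_diff)
      thus "norm ((f x + g x)\<^sup>2) \<le> norm (2 * (f x)\<^sup>2 + 2 * (g x)\<^sup>2)"
        by simp
    qed
  qed measurable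
  thus ?thesis by (auto simp: L2_def)
qed

lemma L2_cmult: "f \<in> L2 \<mu> \<Longrightarrow> (\<lambda>x. c * f x) \<in> L2 \<mu>"
  by (auto simp: L2_def power_mult_distrib)

lemma L2_diff: "f \<in> L2 \<mu> \<Longrightarrow> g \<in> L2 \<mu> \<Longrightarrow> (\<lambda>x. f x - g x) \<in> L2 \<mu>"
  using L2_add[of f \<mu> "\<lambda>x. - 1 * g x"] L2_cmult[of g \<mu> "- 1"] by simp

lemma L2_sum: "(\<And>i. i \<in> I \<Longrightarrow> f i \<in> L2 \<mu>) \<Longrightarrow> (\<lambda>x. \<Sum>i\<in>I. f i x) \<in> L2 \<mu>"
proof (induction I rule: infinite_finite_induct)
  case (insert i I)
  thus ?case using L2_add[of "f i" \<mu> "\<lambda>x. \<Sum>i\<in>I. f i x"] by simp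
qed (auto simp: L2_def)

lemma L2_mult_integrable:
  assumes "f \<in> L2 \<mu>" "g \<in> L2 \<mu>"
  shows "integrable \<mu> (\<lambda>x. f x * g x)"
proof -
  have "integrable \<mu> (\<lambda>x. ((f x + g x)\<^sup>2 - (f x)\<^sup>2 - (g x)\<^sup>2) / 2)"
    using assms L2_add[OF assms] by (auto simp: L2_def)
  thus ?thesis by (simp add: power2_sum)
qed

lemma L2_norm_nonneg: "0 \<le> L2_norm \<mu> f"
  by (simp add: L2_norm_def)

lemma L2_norm_triangle:
  assumes "f \<in> L2 \<mu>" "g \<in> L2 \<mu>"
  shows "L2_norm \<mu> (\<lambda>x. f x + g x) \<le> L2_norm \<mu> f + L2_norm \<mu> g"
proof -
  let ?F = "\<integral>x. (f x)\<^sup>2 \<partial>\<mu>" and ?G = "\<integral>x. (g x)\<^sup>2 \<partial>\<mu>" and ?I = "\<integral>x. f x * g x \<partial>\<mu>"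
  have int: "integrable \<mu> (\<lambda>x. (f x)\<^sup>2)" "integrable \<mu> (\<lambda>x. (g x)\<^sup>2)"
      "integrable \<mu> (\<lambda>x. f x * g x)"
    using assms L2_mult_integrable by (auto simp: L2_def)
  have quad: "0 \<le> a\<^sup>2 * ?F - 2 * a * b * ?I + b\<^sup>2 * ?G" for a b :: real
  proof -
    have "0 \<le> (\<integral>x. (a * f x - b * g x)\<^sup>2 \<partial>\<mu>)" by simp
    also have "(\<lambda>x. (a * f x - b * g x)\<^sup>2) =
        (\<lambda>x. a\<^sup>2 * (f x)\<^sup>2 - 2 * a * b * (f x * g x) + b\<^sup>2 * (g x)\<^sup>2)"
      by (auto simp: fun_eq_iff power2_diff power_mult_distrib algebra_simps)
    also have "(\<integral>x. a\<^sup>2 * (f x)\<^sup>2 - 2 * a * b * (f x * g x) + b\<^sup>2 * (g x)\<^sup>2 \<partial>\<mu>) =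
        a\<^sup>2 * ?F - 2 * a * b * ?I + b\<^sup>2 * ?G"
      using int by (simp add: Bochner_Integration.integral_add Bochner_Integration.integral_diff)
    finally show ?thesis .
  qed
  have FG: "0 \<le> ?F" "0 \<le> ?G" by simp_all
  have "?I\<^sup>2 \<le> ?F * ?G"
  proof (cases "?F = 0")
    case True
    have "?I = 0"
    proof (rule ccontr)
      assume "?I \<noteq> 0"
      hence "2 * ((?G + 1) / (2 * ?I)) * ?I = ?G + 1" by simp
      with quad[of "(?G + 1) / (2 * ?I)" 1] True show False by simp
    qed
    thus ?thesis using True by simp
  next
    case False
    hence "0 < ?F" using FG by linarith
    have "0 \<le> ?I\<^sup>2 * ?F - 2 * ?I * ?F * ?I + ?F\<^sup>2 * ?G" by (rule quad)
    also have "\<dots> = ?F * (?F * ?G - ?I\<^sup>2)" by (simp add: power2_eq_square algebra_simps)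
    finally show ?thesis using \<open>0 < ?F\<close> by (simp add: zero_le_mult_iff)
  qed
  hence CS: "?I \<le> sqrt ?F * sqrt ?G"
    by (metis real_le_rsqrt real_sqrt_mult)
  have "(\<integral>x. (f x + g x)\<^sup>2 \<partial>\<mu>) = ?F + ?G + 2 * ?I"
    using int by (simp add: power2_sum mult.assoc)
  also have "\<dots> \<le> (sqrt ?F + sqrt ?G)\<^sup>2"
    using CS FG by (simp add: power2_sum)
  finally show ?thesis
    unfolding L2_norm_def using FG by (intro real_le_lsqrt) auto
qed

lemma L2_norm_diff_le:
  assumes "f \<in> L2 \<mu>" "g \<in> L2 \<mu>"
  shows "\<bar>L2_norm \<mu> f - L2_norm \<mu> g\<bar> \<le> L2_norm \<mu> (\<lambda>x. f x - g x)"
proof -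
  have "L2_norm \<mu> (\<lambda>x. g x - f x) = L2_norm \<mu> (\<lambda>x. f x - g x)"
    by (simp add: L2_norm_def power2_commute)
  thus ?thesis
    using L2_norm_triangle[OF L2_diff[OF assms] assms(2)]
      L2_norm_triangle[OF L2_diff[OF assms(2,1)] assms(1)] by simp
qed

lemma space_L2_borel: "space (L2_borel \<mu>) = L2 \<mu>"
  by (simp add: L2_borel_def space_measure_of_conv)

lemma sets_L2_borel: "sets (L2_borel \<mu>) = sigma_sets (L2 \<mu>) {U. L2_open \<mu> U}"
  by (auto simp: L2_borel_def L2_open_def intro!: sets_measure_of)

lemma L2_norm_diff_measurable:
  assumes "f \<in> L2 \<mu>"
  shows "(\<lambda>y. L2_norm \<mu> (\<lambda>x. y x - f x)) \<in> borel_measurable (L2_borel \<mu>)"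
proof (rule borel_measurableI)
  fix S :: "real set" assume "open S"
  let ?N = "\<lambda>y. L2_norm \<mu> (\<lambda>x. y x - f x)"
  have "L2_open \<mu> (?N -` S \<inter> L2 \<mu>)"
    unfolding L2_open_def
  proof (intro conjI ballI)
    fix y assume y: "y \<in> ?N -` S \<inter> L2 \<mu>"
    then obtain e where e: "e > 0" "\<And>r. dist r (?N y) < e \<Longrightarrow> r \<in> S"
      using \<open>open S\<close> unfolding open_dist by blast
    show "\<exists>e>0. \<forall>g\<in>L2 \<mu>. L2_norm \<mu> (\<lambda>x. g x - y x) < e \<longrightarrow> g \<in> ?N -` S \<inter> L2 \<mu>"
    proof (intro exI[of _ e] conjI ballI impI)
      fix g assume g: "g \<in> L2 \<mu>" "L2_norm \<mu> (\<lambda>x. g x - y x) < e"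
      have "\<bar>?N g - ?N y\<bar> \<le> L2_norm \<mu> (\<lambda>x. g x - y x)"
        using L2_norm_diff_le[OF L2_diff[OF g(1) assms] L2_diff[OF _ assms, of y]] y by simp
      hence "?N g \<in> S" using g by (intro e(2)) (simp add: dist_real_def)
      thus "g \<in> ?N -` S \<inter> L2 \<mu>" using g by simp
    qed (rule e(1))
  qed auto
  thus "?N -` S \<inter> space (L2_borel \<mu>) \<in> sets (L2_borel \<mu>)"
    by (auto simp: space_L2_borel sets_L2_borel)
qed

lemma L2_borel_AE_cong:
  assumes "A \<in> sets (L2_borel \<mu>)" "f \<in> L2 \<mu>" "g \<in> L2 \<mu>" "AE x in \<mu>. f x = g x"
  shows "f \<in> A \<longleftrightarrow> g \<in> A"
  using assms(1) unfolding sets_L2_borel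
proof (induction A rule: sigma_sets.induct)
  case (Basic U)
  have [measurable]: "f \<in> borel_measurable \<mu>" "g \<in> borel_measurable \<mu>"
    using assms by (auto simp: L2_def)
  have "(\<integral>x. (f x - g x)\<^sup>2 \<partial>\<mu>) = (\<integral>x. 0 \<partial>\<mu>)"
    by (rule integral_cong_AE) (use assms(4) in auto)
  hence "L2_norm \<mu> (\<lambda>x. f x - g x) = 0" "L2_norm \<mu> (\<lambda>x. g x - f x) = 0"
    by (simp_all add: L2_norm_def power2_commute)
  thus ?case using Basic assms(2,3) by (auto simp: L2_open_def)
qed (use assms(2,3) in auto)

text \<open>A Gaussian variable may be degenerate (almost surely constant).\<close>

definition gaussian_variable :: "'o measure \<Rightarrow> ('o \<Rightarrow> real) \<Rightarrow> bool" where
  "gaussian_variable M X \<longleftrightarrow> X \<in> borel_measurable M \<and>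
     ((\<exists>m. AE \<omega> in M. X \<omega> = m) \<or>
      (\<exists>m s. 0 < s \<and> distributed M lborel X (\<lambda>x. ennreal (normal_density m s x))))"

definition gaussian_process :: "'o measure \<Rightarrow> 'i set \<Rightarrow> ('i \<Rightarrow> 'o \<Rightarrow> real) \<Rightarrow> bool" where
  "gaussian_process M I X \<longleftrightarrow>
     (\<forall>J c. finite J \<and> J \<subseteq> I \<longrightarrow> gaussian_variable M (\<lambda>\<omega>. \<Sum>i\<in>J. c i * X i \<omega>))"

definition noise_assumption ::
  "'o measure \<Rightarrow> 'a measure \<Rightarrow> real \<Rightarrow> real \<Rightarrow> ('o \<Rightarrow> 'a \<Rightarrow> real) \<Rightarrow> bool" where
  "noise_assumption M \<mu> \<sigma>bar \<Delta> w \<longleftrightarrow>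
     w \<in> measurable M (L2_borel \<mu>) \<and>
     gaussian_process M (L2 \<mu>) (\<lambda>f \<omega>. L2_inner \<mu> f (w \<omega>)) \<and>
     integrable M (\<lambda>\<omega>. L2_norm \<mu> (w \<omega>) ^ 4) \<and>
     (\<forall>f\<in>L2 \<mu>.
        gaussian_variable M (\<lambda>\<omega>. L2_inner \<mu> f (w \<omega>)) \<and>
        prob_space.expectation M (\<lambda>\<omega>. L2_inner \<mu> f (w \<omega>)) = 0 \<and>
        prob_space.variance M (\<lambda>\<omega>. L2_inner \<mu> f (w \<omega>)) \<le> \<sigma>bar\<^sup>2 * \<Delta> * (L2_norm \<mu> f)\<^sup>2)"


section \<open>Features and mixtures\<close>

text \<open>
  \<open>h\<close> takes the location first and the scale second.
\<close>

definition smooth_features ::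
  "'a::line_or_torus measure \<Rightarrow> ('a \<Rightarrow> real \<Rightarrow> real) \<Rightarrow> real \<Rightarrow> bool" where
  "smooth_features \<mu> h \<sigma> \<longleftrightarrow>
     class_C 3 (\<lambda>\<theta>. h \<theta> \<sigma>) \<and>
     L2_norm Leb (\<lambda>\<theta>. h \<theta> \<sigma>) = 1 \<and>
     (\<forall>\<theta>. 0 < L2_norm \<mu> (\<lambda>x. h (\<theta> - x) \<sigma>)) \<and>
     (\<forall>i\<le>3. (Deriv ^^ i) (\<lambda>\<theta>. h \<theta> \<sigma>) \<in> L2 Leb) \<and>
     (\<forall>\<theta>. \<forall>i\<le>3. (\<lambda>x. (Deriv ^^ i) (\<lambda>\<theta>'. h \<theta>' \<sigma>) (\<theta> - x)) \<in> L2 \<mu>)"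

definition feature ::
  "'a::line_or_torus measure \<Rightarrow> ('a \<Rightarrow> real \<Rightarrow> real) \<Rightarrow> real \<Rightarrow> 'a \<Rightarrow> 'a \<Rightarrow> real" where
  "feature \<mu> h \<sigma> \<theta> = (\<lambda>x. h (\<theta> - x) \<sigma> / L2_norm \<mu> (\<lambda>x. h (\<theta> - x) \<sigma>))"

text \<open>
  An \<open>s\<close>-tuple is a list of length \<open>s\<close>, indexed from \<open>0\<close>; the only \<open>0\<close>-tuple is the empty list.
\<close>

definition nonzero_tuples :: "nat \<Rightarrow> real list set" where
  "nonzero_tuples s = {\<beta>. length \<beta> = s \<and> 0 \<notin> set \<beta>}"

definition separated_tuples :: "'a::metric_space set \<Rightarrow> nat \<Rightarrow> real \<Rightarrow> 'a list set" where
  "separated_tuples A s \<delta> = {\<theta>. length \<theta> = s \<and> set \<theta> \<subseteq> A \<and>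
     (\<forall>k<s. \<forall>l<s. k \<noteq> l \<longrightarrow> dist (\<theta> ! l) (\<theta> ! k) > \<delta>)}"

definition mixture :: "('a \<Rightarrow> 'a \<Rightarrow> real) \<Rightarrow> real list \<Rightarrow> 'a list \<Rightarrow> 'a \<Rightarrow> real" where
  "mixture \<phi> \<beta> \<theta> = (\<lambda>x. \<Sum>k<length \<beta>. \<beta> ! k * \<phi> (\<theta> ! k) x)"


section \<open>The test problem\<close>

definition H0 ::
  "'a::line_or_torus measure \<Rightarrow> ('a \<Rightarrow> 'a \<Rightarrow> real) \<Rightarrow> 'a set \<Rightarrow> nat \<Rightarrow> real \<Rightarrow>
   real list \<Rightarrow> 'a list \<Rightarrow> (real list \<times> 'a list) set" where
  "H0 \<mu> \<phi> A s \<delta> \<beta>\<^sub>0 \<theta>\<^sub>0 = {(\<beta>, \<theta>).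
     \<beta> \<in> nonzero_tuples s \<and> \<theta> \<in> separated_tuples A s \<delta> \<and>
     (AE x in \<mu>. mixture \<phi> \<beta> \<theta> x = mixture \<phi> \<beta>\<^sub>0 \<theta>\<^sub>0 x)}"

definition H1 ::
  "'a::line_or_torus measure \<Rightarrow> ('a \<Rightarrow> 'a \<Rightarrow> real) \<Rightarrow> 'a set \<Rightarrow> nat \<Rightarrow> real \<Rightarrow>
   real list \<Rightarrow> 'a list \<Rightarrow> real \<Rightarrow> (real list \<times> 'a list) set" where
  "H1 \<mu> \<phi> A s \<delta> \<beta>\<^sub>0 \<theta>\<^sub>0 \<rho> = {(\<beta>, \<theta>).
     \<beta> \<in> nonzero_tuples s \<and> \<theta> \<in> separated_tuples A s \<delta> \<and>
     L2_norm \<mu> (\<lambda>x. mixture \<phi> \<beta> \<theta> x - mixture \<phi> \<beta>\<^sub>0 \<theta>\<^sub>0 x) \<ge> \<rho>}"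

definition is_test :: "'a measure \<Rightarrow> (('a \<Rightarrow> real) \<Rightarrow> real) \<Rightarrow> bool" where
  "is_test \<mu> \<Psi> \<longleftrightarrow> \<Psi> \<in> borel_measurable (L2_borel \<mu>) \<and> (\<forall>y\<in>L2 \<mu>. \<Psi> y \<in> {0, 1})"

text \<open>Expectation of \<open>F y\<close> when the observation is \<open>y = \<beta>\<Phi>(\<theta>) + w\<close>.\<close>

definition E_obs ::
  "'o measure \<Rightarrow> ('o \<Rightarrow> 'a \<Rightarrow> real) \<Rightarrow> ('a \<Rightarrow> 'a \<Rightarrow> real) \<Rightarrow> real list \<Rightarrow> 'a list \<Rightarrow>
   (('a \<Rightarrow> real) \<Rightarrow> real) \<Rightarrow> real" where
  "E_obs M w \<phi> \<beta> \<theta> F = prob_space.expectation M (\<lambda>\<omega>. F (\<lambda>x. mixture \<phi> \<beta> \<theta> x + w \<omega> x))"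

text \<open>
  The risk takes values in \<open>ennreal\<close>, so that the supremum over an empty hypothesis is \<open>0\<close>.
\<close>

definition testing_risk ::
  "'o measure \<Rightarrow> ('o \<Rightarrow> 'a \<Rightarrow> real) \<Rightarrow> 'a::line_or_torus measure \<Rightarrow> ('a \<Rightarrow> 'a \<Rightarrow> real) \<Rightarrow>
   'a set \<Rightarrow> nat \<Rightarrow> real \<Rightarrow> real list \<Rightarrow> 'a list \<Rightarrow> real \<Rightarrow> (('a \<Rightarrow> real) \<Rightarrow> real) \<Rightarrow> ennreal" where
  "testing_risk M w \<mu> \<phi> A s \<delta> \<beta>\<^sub>0 \<theta>\<^sub>0 \<rho> \<Psi> =
     (SUP (\<beta>, \<theta>)\<in>H0 \<mu> \<phi> A s \<delta> \<beta>\<^sub>0 \<theta>\<^sub>0. ennreal (E_obs M w \<phi> \<beta> \<theta> \<Psi>)) +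
     (SUP (\<beta>, \<theta>)\<in>H1 \<mu> \<phi> A s \<delta> \<beta>\<^sub>0 \<theta>\<^sub>0 \<rho>. ennreal (E_obs M w \<phi> \<beta> \<theta> (\<lambda>y. 1 - \<Psi> y)))"

definition Test1 ::
  "'o measure \<Rightarrow> ('o \<Rightarrow> 'a \<Rightarrow> real) \<Rightarrow> 'a measure \<Rightarrow> ('a \<Rightarrow> 'a \<Rightarrow> real) \<Rightarrow>
   real list \<Rightarrow> 'a list \<Rightarrow> ('a \<Rightarrow> real) \<Rightarrow> real" where
  "Test1 M w \<mu> \<phi> \<beta>\<^sub>0 \<theta>\<^sub>0 y =
     (L2_norm \<mu> (\<lambda>x. y x - mixture \<phi> \<beta>\<^sub>0 \<theta>\<^sub>0 x))\<^sup>2 -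
     prob_space.expectation M (\<lambda>\<omega>. (L2_norm \<mu> (w \<omega>))\<^sup>2)"

definition Psi_Test1 ::
  "'o measure \<Rightarrow> ('o \<Rightarrow> 'a \<Rightarrow> real) \<Rightarrow> 'a measure \<Rightarrow> ('a \<Rightarrow> 'a \<Rightarrow> real) \<Rightarrow>
   real list \<Rightarrow> 'a list \<Rightarrow> real \<Rightarrow> ('a \<Rightarrow> real) \<Rightarrow> real" where
  "Psi_Test1 M w \<mu> \<phi> \<beta>\<^sub>0 \<theta>\<^sub>0 t y = (if \<bar>Test1 M w \<mu> \<phi> \<beta>\<^sub>0 \<theta>\<^sub>0 y\<bar> > t then 1 else 0)"

lemma feature_L2: "smooth_features \<mu> h \<sigma> \<Longrightarrow> feature \<mu> h \<sigma> \<theta> \<in> L2 \<mu>"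
proof -
  assume "smooth_features \<mu> h \<sigma>"
  hence "(\<lambda>x. (Deriv ^^ 0) (\<lambda>\<theta>'. h \<theta>' \<sigma>) (\<theta> - x)) \<in> L2 \<mu>"
    unfolding smooth_features_def by blast
  from L2_cmult[OF this, of "1 / L2_norm \<mu> (\<lambda>x. h (\<theta> - x) \<sigma>)"] show ?thesis
    by (simp add: feature_def)
qed

lemma mixture_L2: "(\<And>\<theta>. \<phi> \<theta> \<in> L2 \<mu>) \<Longrightarrow> mixture \<phi> \<beta> \<theta> \<in> L2 \<mu>"
  unfolding mixture_def by (intro L2_sum L2_cmult)

lemma is_test_Psi_Test1:
  assumes "smooth_features \<mu> h \<sigma>"
  shows "is_test \<mu> (Psi_Test1 M w \<mu> (feature \<mu> h \<sigma>) \<beta>\<^sub>0 \<theta>\<^sub>0 t)"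
proof -
  have [measurable]: "(\<lambda>y. L2_norm \<mu> (\<lambda>x. y x - mixture (feature \<mu> h \<sigma>) \<beta>\<^sub>0 \<theta>\<^sub>0 x))
      \<in> borel_measurable (L2_borel \<mu>)"
    by (intro L2_norm_diff_measurable mixture_L2 feature_L2 assms)
  have "(\<lambda>y. Psi_Test1 M w \<mu> (feature \<mu> h \<sigma>) \<beta>\<^sub>0 \<theta>\<^sub>0 t y) \<in> borel_measurable (L2_borel \<mu>)"
    unfolding Psi_Test1_def Test1_def by measurable
  moreover have "\<forall>y\<in>L2 \<mu>. Psi_Test1 M w \<mu> (feature \<mu> h \<sigma>) \<beta>\<^sub>0 \<theta>\<^sub>0 t y \<in> {0, 1}"
    by (simp add: Psi_Test1_def)
  ultimately show ?thesis
    unfolding is_test_def by (rule conjI)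
qed

text \<open>Whenever the null hypothesis is satisfiable, the first term is \<open>E_obs M w \<phi> \<beta>\<^sub>0 \<theta>\<^sub>0 \<Psi>\<close>.\<close>

lemma type_I_error:
  assumes "\<And>\<theta>. \<phi> \<theta> \<in> L2 \<mu>" "w \<in> measurable M (L2_borel \<mu>)" "is_test \<mu> \<Psi>"
    and "H0 \<mu> \<phi> A s \<delta> \<beta>\<^sub>0 \<theta>\<^sub>0 \<noteq> {}"
  shows "(SUP (\<beta>, \<theta>)\<in>H0 \<mu> \<phi> A s \<delta> \<beta>\<^sub>0 \<theta>\<^sub>0. ennreal (E_obs M w \<phi> \<beta> \<theta> \<Psi>)) =
     ennreal (E_obs M w \<phi> \<beta>\<^sub>0 \<theta>\<^sub>0 \<Psi>)"
proof -
  have "E_obs M w \<phi> \<beta> \<theta> \<Psi> = E_obs M w \<phi> \<beta>\<^sub>0 \<theta>\<^sub>0 \<Psi>"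
    if "(\<beta>, \<theta>) \<in> H0 \<mu> \<phi> A s \<delta> \<beta>\<^sub>0 \<theta>\<^sub>0" for \<beta> \<theta>
    unfolding E_obs_def
  proof (rule Bochner_Integration.integral_cong[OF refl])
    fix \<omega> assume "\<omega> \<in> space M"
    hence w: "w \<omega> \<in> L2 \<mu>"
      using measurable_space[OF assms(2)] by (simp add: space_L2_borel)
    let ?f = "\<lambda>x. mixture \<phi> \<beta> \<theta> x + w \<omega> x" and ?g = "\<lambda>x. mixture \<phi> \<beta>\<^sub>0 \<theta>\<^sub>0 x + w \<omega> x"
    have f: "?f \<in> L2 \<mu>" and g: "?g \<in> L2 \<mu>"
      by (intro L2_add mixture_L2 assms(1) w)+
    have ae: "AE x in \<mu>. ?f x = ?g x"
      using that by (auto simp: H0_def)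
    have "\<Psi> -` {\<Psi> ?f} \<inter> space (L2_borel \<mu>) \<in> sets (L2_borel \<mu>)"
      using assms(3) by (intro measurable_sets[of \<Psi> _ borel]) (auto simp: is_test_def)
    from L2_borel_AE_cong[OF this f g ae] f g show "\<Psi> ?f = \<Psi> ?g"
      by (auto simp: space_L2_borel)
  qed
  hence "(SUP (\<beta>, \<theta>)\<in>H0 \<mu> \<phi> A s \<delta> \<beta>\<^sub>0 \<theta>\<^sub>0. ennreal (E_obs M w \<phi> \<beta> \<theta> \<Psi>)) =
     (SUP _\<in>H0 \<mu> \<phi> A s \<delta> \<beta>\<^sub>0 \<theta>\<^sub>0. ennreal (E_obs M w \<phi> \<beta>\<^sub>0 \<theta>\<^sub>0 \<Psi>))"
    by (intro SUP_cong) auto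
  thus ?thesis using assms(4) by simp
qed

end

theory Submission
  imports Defs
begin

text \<open>
  Write \<open>d\<close> for the difference between the observed mixture and the reference mixture, so that the
  statistic compares \<open>\<parallel>d + w\<parallel>\<^sup>2\<close> with the expectation of \<open>\<parallel>w\<parallel>\<^sup>2\<close>, and write \<open>N\<close> for the centred
  energy \<open>\<parallel>w\<parallel>\<^sup>2 - \<E> \<parallel>w\<parallel>\<^sup>2\<close>, whose variance is \<open>\<Xi>\<close>.  Expanding the square gives
  \<open>Test1 = \<parallel>d\<parallel>\<^sup>2 + 2 \<langle>d, w\<rangle> + N\<close>.

  Under the null hypothesis \<open>d = 0\<close>, so a false rejection means \<open>\<bar>N\<bar> > t\<close>, and Chebyshev's
  inequality bounds its probability by \<open>\<Xi> / t\<^sup>2\<close>.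

  Under the alternative put \<open>r = \<parallel>d\<parallel> \<ge> \<rho>\<close>.  Acceptance forces \<open>2 \<langle>d, w\<rangle> + N \<le> t - r\<^sup>2 < 0\<close>, so
  at least one of the two summands is responsible for half of this deficit: either
  \<open>\<bar>N\<bar> \<ge> (r\<^sup>2 - t) / 2\<close>, which Chebyshev's inequality controls by \<open>4 \<Xi> / (r\<^sup>2 - t)\<^sup>2\<close>, or
  \<open>\<langle>d, w\<rangle> \<le> - (r\<^sup>2 - t) / 4\<close>.  The latter is a lower deviation of a centred Gaussian variable whose
  variance is at most \<open>\<sigma>bar\<^sup>2 * \<Delta> * r\<^sup>2\<close>, and \<open>gaussian_variable_lower_tail\<close> bounds it by
  \<open>exp (- (r\<^sup>2 - t)\<^sup>2 / (32 * \<sigma>bar\<^sup>2 * \<Delta> * r\<^sup>2))\<close>.  Both \<open>r\<^sup>2 - t\<close> and \<open>(r\<^sup>2 - t) / r = r - t / r\<close>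
  increase with \<open>r\<close>, so the worst case is \<open>r = \<rho>\<close>.
\<close>

section \<open>Lower tails of Gaussian variables\<close>

text \<open>
  This is the pointwise form of the Chernoff bound with the optimal parameter: the density centred
  at \<open>- a\<close> is the exponential tilt of the one centred at \<open>0\<close>, and the tilting factor is monotone in
  \<open>x\<close>, so its value at the end point \<open>x = - a\<close> serves on the whole tail.
\<close>

lemma normal_density_le_tilted:
  assumes "0 < s" "0 \<le> a" "x \<le> - a"
  shows "normal_density 0 s x \<le> exp (- a\<^sup>2 / (2 * s\<^sup>2)) * normal_density (- a) s x"
proof -
  have "a * a \<le> a * (- x)"
    using assms by (intro mult_left_mono) auto
  hence "- x\<^sup>2 \<le> - a\<^sup>2 + - (x + a)\<^sup>2"
    by (simp add: power2_eq_square algebra_simps)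
  hence "- x\<^sup>2 / (2 * s\<^sup>2) \<le> (- a\<^sup>2 + - (x + a)\<^sup>2) / (2 * s\<^sup>2)"
    by (rule divide_right_mono) simp
  also have "\<dots> = - a\<^sup>2 / (2 * s\<^sup>2) + - (x + a)\<^sup>2 / (2 * s\<^sup>2)"
    by (rule add_divide_distrib)
  finally have "exp (- x\<^sup>2 / (2 * s\<^sup>2)) \<le> exp (- a\<^sup>2 / (2 * s\<^sup>2)) * exp (- (x + a)\<^sup>2 / (2 * s\<^sup>2))"
    by (simp add: exp_add[symmetric])
  hence "1 / sqrt (2 * pi * s\<^sup>2) * exp (- x\<^sup>2 / (2 * s\<^sup>2)) \<le>
      1 / sqrt (2 * pi * s\<^sup>2) * (exp (- a\<^sup>2 / (2 * s\<^sup>2)) * exp (- (x + a)\<^sup>2 / (2 * s\<^sup>2)))"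
    by (rule mult_left_mono) simp
  thus ?thesis
    by (simp add: normal_density_def mult_ac)
qed

lemma (in prob_space) normal_lower_tail:
  assumes s: "0 < s" and a: "0 \<le> a" and D: "distributed M lborel X (normal_density 0 s)"
  shows "prob {\<omega> \<in> space M. X \<omega> \<le> - a} \<le> exp (- a\<^sup>2 / (2 * s\<^sup>2))"
proof -
  let ?c = "exp (- a\<^sup>2 / (2 * s\<^sup>2))"
  have "emeasure M {\<omega> \<in> space M. X \<omega> \<le> - a} = emeasure M (X -` {..- a} \<inter> space M)"
    by (rule arg_cong[where f = "emeasure M"]) auto
  also have "\<dots> = (\<integral>\<^sup>+x. ennreal (normal_density 0 s x) * indicator {..- a} x \<partial>lborel)"
    by (rule distributed_emeasure[OF D]) simp
  also have "\<dots> \<le> (\<integral>\<^sup>+x. ennreal ?c * ennreal (normal_density (- a) s x) \<partial>lborel)"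
    using normal_density_le_tilted[OF s a]
    by (intro nn_integral_mono)
      (auto simp: indicator_def ennreal_mult[symmetric] intro!: ennreal_leI)
  also have "\<dots> = ennreal ?c * (\<integral>\<^sup>+x. ennreal (normal_density (- a) s x) \<partial>lborel)"
    by (rule nn_integral_cmult) simp
  also have "(\<integral>\<^sup>+x. ennreal (normal_density (- a) s x) \<partial>lborel) = 1"
    using s by (subst nn_integral_eq_integral) auto
  finally show ?thesis
    by (simp add: emeasure_eq_measure)
qed

text \<open>
  A degenerate variable is also covered: centred and almost surely constant, it vanishes, so it
  never falls below the negative level \<open>- a\<close>.
\<close>

lemma (in prob_space) gaussian_variable_lower_tail:
  assumes X: "gaussian_variable M X" and mean: "expectation X = 0"
    and var: "variance X \<le> v" and a: "0 < a"
  shows "prob {\<omega> \<in> space M. X \<omega> \<le> - a} \<le> exp (- a\<^sup>2 / (2 * v))"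
proof -
  have [measurable]: "X \<in> borel_measurable M"
    using X by (simp add: gaussian_variable_def)
  from X consider m where "AE \<omega> in M. X \<omega> = m"
    | m s where "0 < s" "distributed M lborel X (normal_density m s)"
    unfolding gaussian_variable_def by auto
  thus ?thesis
  proof cases
    case (1 m)
    have "expectation X = expectation (\<lambda>_. m)"
      by (rule integral_cong_AE) (use 1 in auto)
    hence "m = 0"
      using mean by (simp add: prob_space)
    hence "prob {\<omega> \<in> space M. X \<omega> \<le> - a} = 0"
      using 1 a by (intro prob_eq_0[THEN iffD2]) auto
    thus ?thesis by simp
  next
    case (2 m s)
    have "m = 0"
      using normal_distributed_expectation[OF 2] mean by simp
    have "s\<^sup>2 \<le> v"
      using normal_distributed_variance[OF 2] var by simp
    moreover have "0 < s\<^sup>2"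
      using \<open>0 < s\<close> by simp
    ultimately have "a\<^sup>2 / (2 * v) \<le> a\<^sup>2 / (2 * s\<^sup>2)"
      by (intro frac_le) simp_all
    hence "exp (- a\<^sup>2 / (2 * s\<^sup>2)) \<le> exp (- a\<^sup>2 / (2 * v))"
      by simp
    moreover have "prob {\<omega> \<in> space M. X \<omega> \<le> - a} \<le> exp (- a\<^sup>2 / (2 * s\<^sup>2))"
      using normal_lower_tail[of s a X] 2 \<open>m = 0\<close> a by simp
    ultimately show ?thesis
      by (rule order_trans[rotated])
  qed
qed

section \<open>The signal and the energy of the noise\<close>

lemma L2_norm_add_square:
  assumes "f \<in> L2 \<mu>" "g \<in> L2 \<mu>"
  shows "(L2_norm \<mu> (\<lambda>x. f x + g x))\<^sup>2 = (L2_norm \<mu> f)\<^sup>2 + 2 * L2_inner \<mu> f g + (L2_norm \<mu> g)\<^sup>2"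
proof -
  have "integrable \<mu> (\<lambda>x. (f x)\<^sup>2)" "integrable \<mu> (\<lambda>x. (g x)\<^sup>2)" "integrable \<mu> (\<lambda>x. f x * g x)"
    using assms L2_mult_integrable by (auto simp: L2_def)
  moreover have "(L2_norm \<mu> k)\<^sup>2 = (\<integral>x. (k x)\<^sup>2 \<partial>\<mu>)" for k
    by (simp add: L2_norm_def)
  ultimately show ?thesis
    by (simp add: L2_inner_def power2_sum mult.assoc)
qed

text \<open>
  The exponent of the Gaussian tail is \<open>(r - t / r)\<^sup>2\<close> up to a constant, which is why the weakest
  admissible signal is the hardest to detect.
\<close>

lemma signal_to_noise_mono:
  fixes r \<rho> t :: real
  assumes "0 < \<rho>" "\<rho> \<le> r" "0 < t" "t < \<rho>\<^sup>2"
  shows "(\<rho>\<^sup>2 - t)\<^sup>2 / \<rho>\<^sup>2 \<le> (r\<^sup>2 - t)\<^sup>2 / r\<^sup>2"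
proof -
  have "t / r \<le> t / \<rho>"
    using assms by (intro divide_left_mono) auto
  hence "\<rho> - t / \<rho> \<le> r - t / r"
    using assms by linarith
  hence "(\<rho>\<^sup>2 - t) / \<rho> \<le> (r\<^sup>2 - t) / r"
    using assms by (simp add: power2_eq_square diff_divide_distrib)
  hence "((\<rho>\<^sup>2 - t) / \<rho>)\<^sup>2 \<le> ((r\<^sup>2 - t) / r)\<^sup>2"
    using assms by (intro power_mono) auto
  thus ?thesis by (simp add: power_divide)
qed

lemma (in prob_space) noise_energy_square_integrable:
  assumes "noise_assumption M \<mu> \<sigma>bar \<Delta> w"
  shows "(\<lambda>\<omega>. (L2_norm \<mu> (w \<omega>))\<^sup>2) \<in> borel_measurable M"
    and "integrable M (\<lambda>\<omega>. ((L2_norm \<mu> (w \<omega>))\<^sup>2)\<^sup>2)"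
proof -
  have [measurable]: "w \<in> measurable M (L2_borel \<mu>)"
    using assms by (simp add: noise_assumption_def)
  have "(\<lambda>y. L2_norm \<mu> (\<lambda>x. y x - 0)) \<in> borel_measurable (L2_borel \<mu>)"
    by (rule L2_norm_diff_measurable) (simp add: L2_def)
  hence [measurable]: "L2_norm \<mu> \<in> borel_measurable (L2_borel \<mu>)"
    by simp
  show "(\<lambda>\<omega>. (L2_norm \<mu> (w \<omega>))\<^sup>2) \<in> borel_measurable M"
    by measurable
  show "integrable M (\<lambda>\<omega>. ((L2_norm \<mu> (w \<omega>))\<^sup>2)\<^sup>2)"
    using assms by (simp add: noise_assumption_def power_mult[symmetric])
qed

section \<open>The two error probabilities\<close>

text \<open>
  Only the almost everywhere class of the difference of the mixtures enters the norm, so under the null hypothesis the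
  statistic is the centred energy of the noise even if the two mixtures have different parameters.
\<close>

lemma (in prob_space) Psi_Test1_type_I:
  assumes noise: "noise_assumption M \<mu> \<sigma>bar \<Delta> w"
    and meas: "\<And>\<theta>. \<phi> \<theta> \<in> L2 \<mu>"
    and eq: "AE x in \<mu>. mixture \<phi> \<beta> \<theta> x = mixture \<phi> \<beta>\<^sub>0 \<theta>\<^sub>0 x"
    and t: "0 < t"
  shows "E_obs M w \<phi> \<beta> \<theta> (Psi_Test1 M w \<mu> \<phi> \<beta>\<^sub>0 \<theta>\<^sub>0 t)
    \<le> variance (\<lambda>\<omega>. (L2_norm \<mu> (w \<omega>))\<^sup>2) / t\<^sup>2"
proof -
  note [measurable] = noise_energy_square_integrable(1)[OF noise]
  let ?Q = "\<lambda>\<omega>. (L2_norm \<mu> (w \<omega>))\<^sup>2"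
  let ?A = "{\<omega> \<in> space M. t \<le> \<bar>?Q \<omega> - expectation ?Q\<bar>}"
  have A: "?A \<in> events" by measurable
  have "Psi_Test1 M w \<mu> \<phi> \<beta>\<^sub>0 \<theta>\<^sub>0 t (\<lambda>x. mixture \<phi> \<beta> \<theta> x + w \<omega> x) \<le> indicator ?A \<omega>"
    if \<omega>: "\<omega> \<in> space M" for \<omega>
  proof -
    have "w \<omega> \<in> L2 \<mu>"
      using noise \<omega> by (auto simp: noise_assumption_def space_L2_borel dest: measurable_space)
    hence [measurable]: "w \<omega> \<in> borel_measurable \<mu>" by (simp add: L2_def)
    have [measurable]: "mixture \<phi> b u \<in> borel_measurable \<mu>" for b u
      using mixture_L2[of \<phi> \<mu> b u] meas by (simp add: L2_def)
    have "(\<integral>x. (mixture \<phi> \<beta> \<theta> x + w \<omega> x - mixture \<phi> \<beta>\<^sub>0 \<theta>\<^sub>0 x)\<^sup>2 \<partial>\<mu>) = (\<integral>x. (w \<omega> x)\<^sup>2 \<partial>\<mu>)"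
      by (rule integral_cong_AE) (use eq in auto)
    thus ?thesis
      using \<omega> by (simp add: Psi_Test1_def Test1_def L2_norm_def indicator_def)
  qed
  hence "E_obs M w \<phi> \<beta> \<theta> (Psi_Test1 M w \<mu> \<phi> \<beta>\<^sub>0 \<theta>\<^sub>0 t) \<le> expectation (indicator ?A)"
    unfolding E_obs_def using A
    by (intro integral_mono') (auto simp: integrable_indicator_iff less_top[symmetric] Psi_Test1_def)
  also have "\<dots> = prob ?A"
    using A by simp
  also have "\<dots> \<le> variance ?Q / t\<^sup>2"
    using t noise_energy_square_integrable[OF noise] by (intro Chebyshev_inequality) auto
  finally show ?thesis .
qed

text \<open>
  An accepted signal of norm \<open>r\<close> leaves a deficit \<open>r\<^sup>2 - t\<close>, which is split evenly between the centred
  energy of the noise and its correlation with the signal.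
\<close>

lemma (in prob_space) Psi_Test1_type_II_signal:
  fixes \<mu> :: "'c measure" and \<phi> :: "'c \<Rightarrow> 'c \<Rightarrow> real" and \<beta> \<beta>\<^sub>0 :: "real list" and \<theta> \<theta>\<^sub>0 :: "'c list"
  defines "d \<equiv> \<lambda>x. mixture \<phi> \<beta> \<theta> x - mixture \<phi> \<beta>\<^sub>0 \<theta>\<^sub>0 x"
  defines "r \<equiv> L2_norm \<mu> d"
  assumes noise: "noise_assumption M \<mu> \<sigma>bar \<Delta> w"
    and meas: "\<And>\<theta>. \<phi> \<theta> \<in> L2 \<mu>"
    and t: "t < r\<^sup>2"
  shows "E_obs M w \<phi> \<beta> \<theta> (\<lambda>y. 1 - Psi_Test1 M w \<mu> \<phi> \<beta>\<^sub>0 \<theta>\<^sub>0 t y)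
    \<le> 4 * variance (\<lambda>\<omega>. (L2_norm \<mu> (w \<omega>))\<^sup>2) / (r\<^sup>2 - t)\<^sup>2
       + exp (- (r\<^sup>2 - t)\<^sup>2 / (32 * \<sigma>bar\<^sup>2 * \<Delta> * r\<^sup>2))"
proof -
  note [measurable] = noise_energy_square_integrable(1)[OF noise]
  let ?Q = "\<lambda>\<omega>. (L2_norm \<mu> (w \<omega>))\<^sup>2"
  let ?X = "\<lambda>\<omega>. L2_inner \<mu> d (w \<omega>)"
  let ?\<Psi> = "Psi_Test1 M w \<mu> \<phi> \<beta>\<^sub>0 \<theta>\<^sub>0 t"
  define A where "A = {\<omega> \<in> space M. (r\<^sup>2 - t) / 2 \<le> \<bar>?Q \<omega> - expectation ?Q\<bar>}"
  define B where "B = {\<omega> \<in> space M. ?X \<omega> \<le> - ((r\<^sup>2 - t) / 4)}"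
  have d: "d \<in> L2 \<mu>"
    unfolding d_def by (intro L2_diff mixture_L2 meas)
  have "\<forall>f\<in>L2 \<mu>. gaussian_variable M (\<lambda>\<omega>. L2_inner \<mu> f (w \<omega>)) \<and>
      expectation (\<lambda>\<omega>. L2_inner \<mu> f (w \<omega>)) = 0 \<and>
      variance (\<lambda>\<omega>. L2_inner \<mu> f (w \<omega>)) \<le> \<sigma>bar\<^sup>2 * \<Delta> * (L2_norm \<mu> f)\<^sup>2"
    using noise[unfolded noise_assumption_def, THEN conjunct2, THEN conjunct2, THEN conjunct2] .
  note gauss = bspec[OF this d, folded r_def]
  note X = gauss[THEN conjunct1] gauss[THEN conjunct2, THEN conjunct1]
    gauss[THEN conjunct2, THEN conjunct2]
  from X(1) have [measurable]: "?X \<in> borel_measurable M"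
    by (simp add: gaussian_variable_def)
  have A: "A \<in> events" and B: "B \<in> events"
    unfolding A_def B_def by measurable
  have split_deficit: "(u - t) / 2 \<le> \<bar>n\<bar> \<or> x \<le> - ((u - t) / 4)" if "u + 2 * x + n \<le> t" for n u x :: real
    using that by (simp add: field_simps) linarith
  have accept_le: "1 - ?\<Psi> (\<lambda>x. mixture \<phi> \<beta> \<theta> x + w \<omega> x) \<le> indicator A \<omega> + indicator B \<omega>"
    if \<omega>: "\<omega> \<in> space M" for \<omega>
  proof (cases "\<omega> \<in> A \<union> B")
    case True
    have "1 - ?\<Psi> (\<lambda>x. mixture \<phi> \<beta> \<theta> x + w \<omega> x) \<le> 1"
      by (simp add: Psi_Test1_def)
    also have "1 \<le> indicator A \<omega> + (indicator B \<omega> :: real)"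
      using True by (auto simp: indicator_def)
    finally show ?thesis .
  next
    case False
    have "w \<omega> \<in> L2 \<mu>"
      using noise \<omega> by (auto simp: noise_assumption_def space_L2_borel dest: measurable_space)
    from L2_norm_add_square[OF d this]
    have "Test1 M w \<mu> \<phi> \<beta>\<^sub>0 \<theta>\<^sub>0 (\<lambda>x. mixture \<phi> \<beta> \<theta> x + w \<omega> x)
        = r\<^sup>2 + 2 * ?X \<omega> + (?Q \<omega> - expectation ?Q)"
      by (simp add: Test1_def r_def d_def algebra_simps)
    moreover have "\<not> r\<^sup>2 + 2 * ?X \<omega> + (?Q \<omega> - expectation ?Q) \<le> t"
      using False \<omega> split_deficit unfolding A_def B_def by blast
    ultimately have "t < Test1 M w \<mu> \<phi> \<beta>\<^sub>0 \<theta>\<^sub>0 (\<lambda>x. mixture \<phi> \<beta> \<theta> x + w \<omega> x)"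
      by (simp only: not_le)
    hence "?\<Psi> (\<lambda>x. mixture \<phi> \<beta> \<theta> x + w \<omega> x) = 1"
      unfolding Psi_Test1_def by (simp only: less_le_trans[OF _ abs_ge_self] if_True)
    thus ?thesis by simp
  qed
  have int: "integrable M (indicator A :: _ \<Rightarrow> real)" "integrable M (indicator B :: _ \<Rightarrow> real)"
    using A B by (simp_all add: integrable_indicator_iff less_top[symmetric])
  have "E_obs M w \<phi> \<beta> \<theta> (\<lambda>y. 1 - ?\<Psi> y) \<le> expectation (\<lambda>\<omega>. indicator A \<omega> + indicator B \<omega>)"
    unfolding E_obs_def
    by (rule integral_mono'[OF Bochner_Integration.integrable_add[OF int] accept_le])
      (simp_all add: Psi_Test1_def)
  also have "\<dots> = prob A + prob B"
    using A B by (simp add: Bochner_Integration.integral_add[OF int])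
  also have "\<dots> \<le> 4 * variance ?Q / (r\<^sup>2 - t)\<^sup>2 + exp (- (r\<^sup>2 - t)\<^sup>2 / (32 * \<sigma>bar\<^sup>2 * \<Delta> * r\<^sup>2))"
  proof (rule add_mono)
    have "prob A \<le> variance ?Q / ((r\<^sup>2 - t) / 2)\<^sup>2"
      unfolding A_def using t noise_energy_square_integrable[OF noise]
      by (intro Chebyshev_inequality) auto
    also have "\<dots> = 4 * variance ?Q / (r\<^sup>2 - t)\<^sup>2"
      by (simp add: power_divide)
    finally show "prob A \<le> 4 * variance ?Q / (r\<^sup>2 - t)\<^sup>2" .
    have "prob B \<le> exp (- ((r\<^sup>2 - t) / 4)\<^sup>2 / (2 * (\<sigma>bar\<^sup>2 * \<Delta> * r\<^sup>2)))"
      unfolding B_def using t by (intro gaussian_variable_lower_tail[OF X]) simp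
    also have "- ((r\<^sup>2 - t) / 4)\<^sup>2 / (2 * (\<sigma>bar\<^sup>2 * \<Delta> * r\<^sup>2)) = - (r\<^sup>2 - t)\<^sup>2 / (32 * \<sigma>bar\<^sup>2 * \<Delta> * r\<^sup>2)"
      by (simp add: power_divide mult.assoc)
    finally show "prob B \<le> exp (- (r\<^sup>2 - t)\<^sup>2 / (32 * \<sigma>bar\<^sup>2 * \<Delta> * r\<^sup>2))" .
  qed
  finally show ?thesis .
qed

lemma (in prob_space) Psi_Test1_type_II:
  assumes noise: "noise_assumption M \<mu> \<sigma>bar \<Delta> w"
    and meas: "\<And>\<theta>. \<phi> \<theta> \<in> L2 \<mu>"
    and sep: "\<rho> \<le> L2_norm \<mu> (\<lambda>x. mixture \<phi> \<beta> \<theta> x - mixture \<phi> \<beta>\<^sub>0 \<theta>\<^sub>0 x)"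
    and pos: "0 \<le> \<rho>" "0 < t" "t < \<rho>\<^sup>2" "0 < \<sigma>bar" "0 < \<Delta>"
  shows "E_obs M w \<phi> \<beta> \<theta> (\<lambda>y. 1 - Psi_Test1 M w \<mu> \<phi> \<beta>\<^sub>0 \<theta>\<^sub>0 t y)
    \<le> 4 * variance (\<lambda>\<omega>. (L2_norm \<mu> (w \<omega>))\<^sup>2) / (\<rho>\<^sup>2 - t)\<^sup>2
       + exp (- (\<rho>\<^sup>2 - t)\<^sup>2 / (32 * \<sigma>bar\<^sup>2 * \<Delta> * \<rho>\<^sup>2))"
proof -
  define r where "r = L2_norm \<mu> (\<lambda>x. mixture \<phi> \<beta> \<theta> x - mixture \<phi> \<beta>\<^sub>0 \<theta>\<^sub>0 x)"
  let ?V = "variance (\<lambda>\<omega>. (L2_norm \<mu> (w \<omega>))\<^sup>2)"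
  let ?k = "32 * \<sigma>bar\<^sup>2 * \<Delta>"
  have "\<rho> \<noteq> 0" using pos by auto
  hence \<rho>: "0 < \<rho>" "\<rho> \<le> r" using pos sep by (auto simp: r_def)
  have le: "\<rho>\<^sup>2 \<le> r\<^sup>2" using \<rho> by (intro power_mono) auto
  have energy: "4 * ?V / (r\<^sup>2 - t)\<^sup>2 \<le> 4 * ?V / (\<rho>\<^sup>2 - t)\<^sup>2"
    using le pos by (intro divide_left_mono power_mono mult_pos_pos) auto
  have "(\<rho>\<^sup>2 - t)\<^sup>2 / (?k * \<rho>\<^sup>2) \<le> (r\<^sup>2 - t)\<^sup>2 / (?k * r\<^sup>2)"
    using divide_right_mono[OF signal_to_noise_mono[OF \<rho> pos(2,3)], of ?k] pos
    by (simp add: mult.commute)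
  hence correlation: "exp (- (r\<^sup>2 - t)\<^sup>2 / (?k * r\<^sup>2)) \<le> exp (- (\<rho>\<^sup>2 - t)\<^sup>2 / (?k * \<rho>\<^sup>2))"
    by simp
  have "t < r\<^sup>2" using le pos by simp
  from Psi_Test1_type_II_signal[OF noise meas this[unfolded r_def], folded r_def]
  show ?thesis
    by (rule order_trans) (rule add_mono[OF energy correlation])
qed

theorem theorem4p1:
  fixes T s s0 :: nat
    and lam :: "nat \<Rightarrow> 'a::line_or_torus measure"
    and Scales :: "real set" and sig :: "nat \<Rightarrow> real"
    and h :: "'a \<Rightarrow> real \<Rightarrow> real"
    and Theta :: "nat \<Rightarrow> 'a set"
    and M :: "'o measure" and w :: "nat \<Rightarrow> 'o \<Rightarrow> 'a \<Rightarrow> real"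
    and \<sigma>bar :: real and Delta :: "nat \<Rightarrow> real"
    and \<delta>star \<delta>\<^sub>0 \<rho> t :: real
    and \<beta>\<^sub>0 :: "real list" and \<theta>\<^sub>0 :: "'a list"
  assumes "prob_space M"
    and "sets (lam T) = sets borel"
    and "Scales \<subseteq> {0<..}" and "sig T \<in> Scales"
    and "compact_interval (Theta T)"
    and "\<delta>star \<ge> 0" and "\<delta>\<^sub>0 \<ge> 0"
    and "\<beta>\<^sub>0 \<in> nonzero_tuples s0" and "\<theta>\<^sub>0 \<in> separated_tuples (Theta T) s0 \<delta>\<^sub>0"
    and "smooth_features (lam T) h (sig T)"
    and "\<sigma>bar > 0" and "Delta T > 0"
    and "noise_assumption M (lam T) \<sigma>bar (Delta T) (w T)"
    and "\<rho> \<ge> 0" and "\<rho>\<^sup>2 > t" and "t > 0"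
  defines "\<Phi> \<equiv> feature (lam T) h (sig T)"
    and "\<Xi> \<equiv> prob_space.variance M (\<lambda>\<omega>. (L2_norm (lam T) (w T \<omega>))\<^sup>2)"
  shows "testing_risk M (w T) (lam T) \<Phi> (Theta T) s \<delta>star \<beta>\<^sub>0 \<theta>\<^sub>0 \<rho>
           (Psi_Test1 M (w T) (lam T) \<Phi> \<beta>\<^sub>0 \<theta>\<^sub>0 t)
         \<le> ennreal (\<Xi> / t\<^sup>2 + 4 * \<Xi> / (\<rho>\<^sup>2 - t)\<^sup>2
             + exp (- (\<rho>\<^sup>2 - t)\<^sup>2 / (32 * \<sigma>bar\<^sup>2 * Delta T * \<rho>\<^sup>2)))"
proof -
  interpret prob_space M by fact
  have meas: "\<Phi> \<theta> \<in> L2 (lam T)" for \<theta>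
    unfolding \<Phi>_def by (intro feature_L2 assms)
  let ?e = "exp (- (\<rho>\<^sup>2 - t)\<^sup>2 / (32 * \<sigma>bar\<^sup>2 * Delta T * \<rho>\<^sup>2))"
  let ?\<Psi> = "Psi_Test1 M (w T) (lam T) \<Phi> \<beta>\<^sub>0 \<theta>\<^sub>0 t"
  have \<Xi>: "0 \<le> \<Xi>" by (simp add: \<Xi>_def)
  have "(SUP (\<beta>, \<theta>)\<in>H0 (lam T) \<Phi> (Theta T) s \<delta>star \<beta>\<^sub>0 \<theta>\<^sub>0. ennreal (E_obs M (w T) \<Phi> \<beta> \<theta> ?\<Psi>))
      \<le> ennreal (\<Xi> / t\<^sup>2)"
    unfolding \<Xi>_def
    by (rule SUP_least)
      (auto simp: H0_def intro!: ennreal_leI Psi_Test1_type_I[OF assms(13) meas] assms(16))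
  moreover have "(SUP (\<beta>, \<theta>)\<in>H1 (lam T) \<Phi> (Theta T) s \<delta>star \<beta>\<^sub>0 \<theta>\<^sub>0 \<rho>.
      ennreal (E_obs M (w T) \<Phi> \<beta> \<theta> (\<lambda>y. 1 - ?\<Psi> y))) \<le> ennreal (4 * \<Xi> / (\<rho>\<^sup>2 - t)\<^sup>2 + ?e)"
    unfolding \<Xi>_def
    by (rule SUP_least, clarify, rule ennreal_leI, rule Psi_Test1_type_II[OF assms(13) meas])
      (simp_all add: H1_def assms(11,12,14-16))
  ultimately have "testing_risk M (w T) (lam T) \<Phi> (Theta T) s \<delta>star \<beta>\<^sub>0 \<theta>\<^sub>0 \<rho> ?\<Psi>
      \<le> ennreal (\<Xi> / t\<^sup>2) + ennreal (4 * \<Xi> / (\<rho>\<^sup>2 - t)\<^sup>2 + ?e)"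
    unfolding testing_risk_def by (rule add_mono)
  also have "\<dots> = ennreal (\<Xi> / t\<^sup>2 + (4 * \<Xi> / (\<rho>\<^sup>2 - t)\<^sup>2 + ?e))"
    using \<Xi> by (intro ennreal_plus[symmetric]) auto
  finally show ?thesis
    by (simp only: add.assoc)
qed

end
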